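(* For all $\lambda,\mu,\nu,\rho\in\mathcal P$ such that $\lambda\supseteq\mu$ and $\nu\supseteq\rho$, $$g^*_{\lambda,\mu}\cdot g^*_{\nu,\rho}\ \le\ g^*_{\lambda\vee\nu,\ \mu\vee\rho}\cdot g^*_{\lambda\wedge\nu,\ \mu\wedge\rho}.$$
   Context: $\mathcal P$ is the set of all integer partitions, viewed as infinite nonincreasing sequences of nonnegative integers with finitely many nonzero entries; $\vee,\wedge$ are the componentwise maximum and minimum; $\mu\subseteq\lambda$ means $\mu_i\le\lambda_i$ for all $i$. For $\mu\subseteq\lambda$, $g^*_{\lambda,\mu}$ is the number of elegant fillings of the skew shape $\lambda/\mu$: semistandard Young tableaux of shape $\lambda/\mu$ (positive integer entries, weakly increasing along rows, strictly increasing down columns) such that every entry in row $i$ lies in $\{1,2,\ldots,i-1\}$ (so $g^*_{\lambda,\lambda}=1$). *)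

theory Defs
  imports Main "HOL-Library.FuncSet"
begin

text \<open>
  A partition is a sequence \<open>l :: nat \<Rightarrow> nat\<close>, indexed from 0: \<open>l i\<close> is the \<open>(i + 1)\<close>-st part.
  Containment and the componentwise maximum and minimum are the pointwise order
  \<open>\<le>\<close> and the lattice operations \<open>sup\<close> and \<open>inf\<close> on \<open>nat \<Rightarrow> nat\<close>.
\<close>

definition partitions :: "(nat \<Rightarrow> nat) set" where
  "partitions = {l. antimono l \<and> finite {i. l i \<noteq> 0}}"

text \<open>Cells are pairs (row, column), both counted from 0.\<close>

definition skew_shape :: "(nat \<Rightarrow> nat) \<Rightarrow> (nat \<Rightarrow> nat) \<Rightarrow> (nat \<times> nat) set" where
  "skew_shape l m = {(i, j). m i \<le> j \<and> j < l i}"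

text \<open>
  Fillings are extensional functions (\<open>undefined\<close> off the shape), so that two fillings are equal
  iff they agree on the cells of the shape and counting them is meaningful.
\<close>

definition ssyt :: "(nat \<Rightarrow> nat) \<Rightarrow> (nat \<Rightarrow> nat) \<Rightarrow> (nat \<times> nat \<Rightarrow> nat) set" where
  "ssyt l m = {T \<in> skew_shape l m \<rightarrow>\<^sub>E {1..}.
     (\<forall>i j j'. (i, j) \<in> skew_shape l m \<longrightarrow> (i, j') \<in> skew_shape l m \<longrightarrow> j < j' \<longrightarrow>
        T (i, j) \<le> T (i, j')) \<and>
     (\<forall>i i' j. (i, j) \<in> skew_shape l m \<longrightarrow> (i', j) \<in> skew_shape l m \<longrightarrow> i < i' \<longrightarrow>
        T (i, j) < T (i', j))}"

text \<open>
  Row \<open>i\<close> counted from 0 is row \<open>i + 1\<close> counted from 1, so its entries lie in \<open>{1..i}\<close>.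
  In particular there is no elegant filling if the shape has a cell in the top row.
\<close>

definition elegant_fillings :: "(nat \<Rightarrow> nat) \<Rightarrow> (nat \<Rightarrow> nat) \<Rightarrow> (nat \<times> nat \<Rightarrow> nat) set" where
  "elegant_fillings l m =
     {T \<in> ssyt l m. \<forall>(i, j) \<in> skew_shape l m. T (i, j) \<in> {1..i}}"

definition g_star :: "(nat \<Rightarrow> nat) \<Rightarrow> (nat \<Rightarrow> nat) \<Rightarrow> nat" where
  "g_star l m = card (elegant_fillings l m)"

lemma partitions_sup:
  assumes "l \<in> partitions" "m \<in> partitions"
  shows "sup l m \<in> partitions"
proof -
  have "{i. sup l m i \<noteq> 0} \<subseteq> {i. l i \<noteq> 0} \<union> {i. m i \<noteq> 0}"
    by (auto simp: sup_nat_def)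
  then have "finite {i. sup l m i \<noteq> 0}"
    using assms by (auto simp: partitions_def intro: finite_subset)
  moreover have "antimono (sup l m)"
    using assms by (simp add: partitions_def monotone_def sup_nat_def) (meson max.coboundedI1 max.coboundedI2)
  ultimately show ?thesis by (simp add: partitions_def)
qed

lemma partitions_inf:
  assumes "l \<in> partitions" "m \<in> partitions"
  shows "inf l m \<in> partitions"
proof -
  have "{i. inf l m i \<noteq> 0} \<subseteq> {i. l i \<noteq> 0}"
    by (auto simp: inf_nat_def)
  then have "finite {i. inf l m i \<noteq> 0}"
    using assms by (auto simp: partitions_def intro: finite_subset)
  moreover have "antimono (inf l m)"
    using assms by (simp add: partitions_def monotone_def inf_nat_def) (meson min.coboundedI1 min.coboundedI2)
  ultimately show ?thesis by (simp add: partitions_def)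
qed

lemma finite_skew_shape:
  assumes "l \<in> partitions"
  shows "finite (skew_shape l m)"
proof -
  have "skew_shape l m \<subseteq> (SIGMA i:{i. l i \<noteq> 0}. {..<l i})"
    by (auto simp: skew_shape_def)
  moreover have "finite (SIGMA i:{i. l i \<noteq> 0}. {..<l i})"
    using assms by (auto simp: partitions_def)
  ultimately show ?thesis by (rule finite_subset)
qed

lemma finite_elegant_fillings:
  assumes "l \<in> partitions"
  shows "finite (elegant_fillings l m)"
proof -
  have "elegant_fillings l m \<subseteq> PiE (skew_shape l m) (\<lambda>(i, j). {1..i})"
  proof
    fix T assume T: "T \<in> elegant_fillings l m"
    then have "T \<in> extensional (skew_shape l m)"
      by (simp add: elegant_fillings_def ssyt_def PiE_iff)
    moreover have "T c \<in> (case c of (i, j) \<Rightarrow> {1..i})" if "c \<in> skew_shape l m" for c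
      using T that unfolding elegant_fillings_def by (cases c) blast
    ultimately show "T \<in> PiE (skew_shape l m) (\<lambda>(i, j). {1..i})"
      by (simp add: PiE_iff)
  qed
  moreover have "finite (PiE (skew_shape l m) (\<lambda>(i, j). {1..i}))"
    using finite_skew_shape[OF assms] by (auto intro!: finite_PiE)
  ultimately show ?thesis by (rule finite_subset)
qed

lemma g_star_refl: "g_star l l = 1"
proof -
  have "skew_shape l l = {}" by (auto simp: skew_shape_def)
  then have "elegant_fillings l l = {\<lambda>_. undefined}"
    by (auto simp: elegant_fillings_def ssyt_def)
  then show ?thesis by (simp add: g_star_def)
qed

end

theory Submission
  imports Defs
begin

text \<open>
  The inequality is an instance of Daykin's inequality
  \<open>|A| |B| \<le> |{a \<union> b}| |{a \<inter> b}|\<close> for two families \<open>A\<close>, \<open>B\<close> of subsets of a finite set.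

  Extend a filling \<open>T\<close> of \<open>l / m\<close> to all cells by giving the cells of \<open>m\<close> the value \<open>0\<close> and
  the cells outside \<open>l\<close> the value \<open>\<infinity>\<close>, and record the extension by its sublevel sets, that is by
  the finite set of triples \<open>(i, j, k)\<close> with \<open>k \<le> i\<close> such that cell \<open>(i, j)\<close> has value at most
  \<open>k\<close>. In these terms every requirement on an elegant filling that does not mention the shape
  says that one triple in the set forces another one; such requirements survive unions and
  intersections. The shape itself is visible at the two extreme levels: \<open>k = 0\<close> shows \<open>m\<close>, and
  the flag condition (entries of row \<open>i\<close> are at most \<open>i\<close>) makes \<open>k = i\<close> show \<open>l\<close>. So the union of
  an encoding for \<open>l / m\<close> and one for \<open>n / r\<close> is an encoding for \<open>sup l n / sup m r\<close>, their
  intersection is one for \<open>inf l n / inf m r\<close>, and Daykin's inequality does the counting.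

  Daykin's inequality in turn is the four functions theorem of Ahlswede and Daykin for
  indicator functions, which is proved by induction on the ground set.
\<close>

section \<open>The four functions theorem and Daykin's inequality\<close>

text \<open>
  The case of a one-element ground set. Put \<open>p = c1 * d0\<close> and \<open>q = c0 * d1\<close>. Both mixed
  products \<open>x = a1 * b0\<close> and \<open>y = a0 * b1\<close> are at most \<open>p\<close>, and \<open>x * y \<le> p * q\<close>; expanding
  \<open>0 \<le> (p - x) * (p - y)\<close> gives \<open>x + y \<le> p + q\<close>.
\<close>

lemma four_functions_two_point:
  fixes a0 a1 b0 b1 c0 c1 d0 d1 :: "'b::linordered_idom"
  assumes nonneg: "0 \<le> a0" "0 \<le> a1" "0 \<le> b0" "0 \<le> b1" "0 \<le> c0" "0 \<le> c1" "0 \<le> d0" "0 \<le> d1"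
    and h00: "a0 * b0 \<le> c0 * d0" and h01: "a0 * b1 \<le> c1 * d0"
    and h10: "a1 * b0 \<le> c1 * d0" and h11: "a1 * b1 \<le> c1 * d1"
  shows "(a0 + a1) * (b0 + b1) \<le> (c0 + c1) * (d0 + d1)"
proof -
  define x y p q where "x = a1 * b0" and "y = a0 * b1" and "p = c1 * d0" and "q = c0 * d1"
  have xp: "x \<le> p" and yp: "y \<le> p" and q0: "0 \<le> q" and p0: "0 \<le> p"
    using h10 h01 nonneg by (simp_all add: x_def y_def p_def q_def)
  have "(a0 * b0) * (a1 * b1) \<le> (c0 * d0) * (c1 * d1)"
    by (rule mult_mono) (use h00 h11 nonneg in simp_all)
  then have xy: "x * y \<le> p * q"
    by (simp add: x_def y_def p_def q_def ac_simps)
  have "x + y \<le> p + q"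
  proof (cases "p = 0")
    case True
    then show ?thesis using xp yp q0 by (simp)
  next
    case False
    have "0 \<le> (p - x) * (p - y)" using xp yp by simp
    then have "p * (x + y) \<le> p * p + x * y" by (simp add: algebra_simps)
    also have "\<dots> \<le> p * (p + q)" using xy by (simp add: algebra_simps)
    finally show ?thesis using False p0 by (simp add: mult_le_cancel_left)
  qed
  moreover have "(a0 + a1) * (b0 + b1) = a0 * b0 + a1 * b1 + (x + y)"
    and "(c0 + c1) * (d0 + d1) = c0 * d0 + c1 * d1 + (p + q)"
    by (simp_all add: x_def y_def p_def q_def algebra_simps)
  ultimately show ?thesis using h00 h11 by (simp add: add_mono)
qed

lemma sum_Pow_insert:
  fixes f :: "'a set \<Rightarrow> 'b::comm_monoid_add"
  assumes "finite X" "x \<notin> X"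
  shows "sum f (Pow (insert x X)) = (\<Sum>A\<in>Pow X. f A + f (insert x A))"
proof -
  have inj: "inj_on (insert x) (Pow X)"
    using assms(2) by (auto simp: inj_on_def)
  have "sum f (Pow (insert x X)) = sum f (Pow X) + sum f (insert x ` Pow X)"
    unfolding Pow_insert using assms by (intro sum.union_disjoint) auto
  also have "sum f (insert x ` Pow X) = (\<Sum>A\<in>Pow X. f (insert x A))"
    by (simp add: sum.reindex[OF inj])
  finally show ?thesis by (simp add: sum.distrib)
qed

text \<open>
  Ahlswede and Daykin. Summing out one element \<open>x\<close> of the ground set replaces each function \<open>f\<close>
  by \<open>\<lambda>A. f A + f (insert x A)\<close>, and the two-point case says that the hypothesis is inherited.
\<close>

theorem four_functions:
  fixes \<alpha> \<beta> \<gamma> \<delta> :: "'a set \<Rightarrow> 'b::linordered_idom"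
  assumes "finite X"
    and "\<And>A. 0 \<le> \<alpha> A" "\<And>A. 0 \<le> \<beta> A" "\<And>A. 0 \<le> \<gamma> A" "\<And>A. 0 \<le> \<delta> A"
    and "\<And>A B. A \<subseteq> X \<Longrightarrow> B \<subseteq> X \<Longrightarrow> \<alpha> A * \<beta> B \<le> \<gamma> (A \<union> B) * \<delta> (A \<inter> B)"
  shows "sum \<alpha> (Pow X) * sum \<beta> (Pow X) \<le> sum \<gamma> (Pow X) * sum \<delta> (Pow X)"
  using assms
proof (induction X arbitrary: \<alpha> \<beta> \<gamma> \<delta> rule: finite_induct)
  case empty
  from empty(5)[of "{}" "{}"] show ?case by simp
next
  case (insert x X)
  note le = insert.prems(5)
  have "(\<alpha> A + \<alpha> (insert x A)) * (\<beta> B + \<beta> (insert x B))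
      \<le> (\<gamma> (A \<union> B) + \<gamma> (insert x (A \<union> B))) * (\<delta> (A \<inter> B) + \<delta> (insert x (A \<inter> B)))"
    if A: "A \<subseteq> X" and B: "B \<subseteq> X" for A B
  proof (rule four_functions_two_point)
    have x: "x \<notin> A" "x \<notin> B" using A B insert.hyps by auto
    show "\<alpha> A * \<beta> B \<le> \<gamma> (A \<union> B) * \<delta> (A \<inter> B)"
      using A B by (intro le) auto
    show "\<alpha> A * \<beta> (insert x B) \<le> \<gamma> (insert x (A \<union> B)) * \<delta> (A \<inter> B)"
      using le[of A "insert x B"] A B x by (simp add: subset_insertI2)
    show "\<alpha> (insert x A) * \<beta> B \<le> \<gamma> (insert x (A \<union> B)) * \<delta> (A \<inter> B)"
      using le[of "insert x A" B] A B x by (simp add: subset_insertI2)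
    show "\<alpha> (insert x A) * \<beta> (insert x B)
        \<le> \<gamma> (insert x (A \<union> B)) * \<delta> (insert x (A \<inter> B))"
      using le[of "insert x A" "insert x B"] A B by (simp add: subset_insertI2)
  qed (use insert.prems in auto)
  then show ?case
    unfolding sum_Pow_insert[OF insert.hyps]
    by (intro insert.IH) (use insert.prems in \<open>auto intro!: add_nonneg_nonneg\<close>)
qed

theorem Daykin_inequality:
  assumes X: "finite X" and A: "\<A> \<subseteq> Pow X" and B: "\<B> \<subseteq> Pow X"
    and union: "\<And>a b. a \<in> \<A> \<Longrightarrow> b \<in> \<B> \<Longrightarrow> a \<union> b \<in> \<C>"
    and inter: "\<And>a b. a \<in> \<A> \<Longrightarrow> b \<in> \<B> \<Longrightarrow> a \<inter> b \<in> \<D>"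
    and C: "\<C> \<subseteq> Pow X" and D: "\<D> \<subseteq> Pow X"
  shows "card \<A> * card \<B> \<le> card \<C> * card \<D>"
proof -
  define ind :: "'a set set \<Rightarrow> 'a set \<Rightarrow> int" where "ind \<F> a = of_bool (a \<in> \<F>)" for \<F> a
  have card: "sum (ind \<F>) (Pow X) = int (card \<F>)" if "\<F> \<subseteq> Pow X" for \<F>
    using that X by (simp add: ind_def of_bool_def sum.If_cases Int_absorb1)
  have "sum (ind \<A>) (Pow X) * sum (ind \<B>) (Pow X) \<le> sum (ind \<C>) (Pow X) * sum (ind \<D>) (Pow X)"
    using X by (rule four_functions) (auto simp: ind_def union inter)
  then have "int (card \<A> * card \<B>) \<le> int (card \<C> * card \<D>)"
    by (simp add: card A B C D)
  then show ?thesis by (simp only: of_nat_le_iff)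
qed

section \<open>Elegant fillings as sets of triples\<close>

definition triples_below :: "(nat \<Rightarrow> nat) \<Rightarrow> (nat \<times> nat \<times> nat) set" where
  "triples_below l = {(i, j, k). j < l i \<and> k \<le> i}"

text \<open>
  The requirements on a filling that do not mention its shape: levels are cumulative, rows
  increase weakly, columns increase strictly. The column rule stops at \<open>k \<le> i\<close> because row \<open>i\<close>
  has no level above \<open>i\<close>.
\<close>

inductive forces :: "nat \<times> nat \<times> nat \<Rightarrow> nat \<times> nat \<times> nat \<Rightarrow> bool" where
  level: "k \<le> k' \<Longrightarrow> k' \<le> i \<Longrightarrow> forces (i, j, k) (i, j, k')"
| row: "j < j' \<Longrightarrow> forces (i, j', k) (i, j, k)"
| col: "i < i' \<Longrightarrow> k \<le> i \<Longrightarrow> forces (i', j, Suc k) (i, j, k)"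

text \<open>
  The sublevel sets of elegant fillings of \<open>l / m\<close>, characterised intrinsically: the shape is
  read off at the two extreme levels of each row.
\<close>

definition elegant_sets :: "(nat \<Rightarrow> nat) \<Rightarrow> (nat \<Rightarrow> nat) \<Rightarrow> (nat \<times> nat \<times> nat) set set" where
  "elegant_sets l m = {S. S \<subseteq> triples_below l \<and>
     (\<forall>i j. j < l i \<longrightarrow> (i, j, i) \<in> S) \<and>
     (\<forall>i j. (i, j, 0) \<in> S \<longleftrightarrow> j < m i) \<and>
     (\<forall>t t'. forces t t' \<longrightarrow> t \<in> S \<longrightarrow> t' \<in> S)}"

lemma elegant_setsD:
  assumes "S \<in> elegant_sets l m"
  shows "(i, j, k) \<in> S \<Longrightarrow> j < l i \<and> k \<le> i"
    and "j < l i \<Longrightarrow> (i, j, i) \<in> S"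
    and "(i, j, 0) \<in> S \<longleftrightarrow> j < m i"
    and "forces t t' \<Longrightarrow> t \<in> S \<Longrightarrow> t' \<in> S"
  using assms unfolding elegant_sets_def triples_below_def by blast+

definition set_of_filling ::
    "(nat \<Rightarrow> nat) \<Rightarrow> (nat \<Rightarrow> nat) \<Rightarrow> (nat \<times> nat \<Rightarrow> nat) \<Rightarrow> (nat \<times> nat \<times> nat) set" where
  "set_of_filling l m T = {(i, j, k). k \<le> i \<and> (j < m i \<or> j < l i \<and> T (i, j) \<le> k)}"

definition filling_of_set ::
    "(nat \<Rightarrow> nat) \<Rightarrow> (nat \<Rightarrow> nat) \<Rightarrow> (nat \<times> nat \<times> nat) set \<Rightarrow> nat \<times> nat \<Rightarrow> nat" where
  "filling_of_set l m S = (\<lambda>(i, j)\<in>skew_shape l m. LEAST k. (i, j, k) \<in> S)"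

lemma finite_triples_below:
  assumes "l \<in> partitions"
  shows "finite (triples_below l)"
proof -
  have "triples_below l \<subseteq> (SIGMA i:{i. l i \<noteq> 0}. {..<l i} \<times> {..i})"
    by (auto simp: triples_below_def)
  moreover have "finite (SIGMA i:{i. l i \<noteq> 0}. {..<l i} \<times> {..i})"
    using assms by (auto simp: partitions_def)
  ultimately show ?thesis by (rule finite_subset)
qed

lemma triples_below_mono: "l \<le> l' \<Longrightarrow> triples_below l \<subseteq> triples_below l'"
  by (fastforce simp: triples_below_def le_fun_def dest: order_less_le_trans)

lemma elegant_sets_subset: "elegant_sets l m \<subseteq> Pow (triples_below l)"
  by (auto simp: elegant_sets_def)

text \<open>
  A rule of \<open>forces\<close> has a single premise, so it can be applied inside whichever of the two sets
  contains that premise; a rule with two premises would not survive the union.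
\<close>

lemma elegant_sets_union:
  assumes "S \<in> elegant_sets l m" "S' \<in> elegant_sets n r"
  shows "S \<union> S' \<in> elegant_sets (sup l n) (sup m r)"
proof -
  note S = elegant_setsD[OF assms(1)] and S' = elegant_setsD[OF assms(2)]
  have "S \<union> S' \<subseteq> triples_below (sup l n)"
    by (auto simp: triples_below_def sup_nat_def less_max_iff_disj dest: S(1) S'(1))
  moreover have "(i, j, i) \<in> S \<union> S'" if "j < sup l n i" for i j
    using that S(2)[of j i] S'(2)[of j i] by (auto simp: sup_nat_def less_max_iff_disj)
  moreover have "(i, j, 0) \<in> S \<union> S' \<longleftrightarrow> j < sup m r i" for i j
    by (auto simp: sup_nat_def less_max_iff_disj S(3) S'(3))
  moreover have "t' \<in> S \<union> S'" if "forces t t'" "t \<in> S \<union> S'" for t t'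
    using that(2) S(4)[OF that(1)] S'(4)[OF that(1)] by blast
  ultimately show ?thesis
    by (simp add: elegant_sets_def)
qed

lemma elegant_sets_inter:
  assumes "S \<in> elegant_sets l m" "S' \<in> elegant_sets n r"
  shows "S \<inter> S' \<in> elegant_sets (inf l n) (inf m r)"
proof -
  note S = elegant_setsD[OF assms(1)] and S' = elegant_setsD[OF assms(2)]
  have "S \<inter> S' \<subseteq> triples_below (inf l n)"
    by (auto simp: triples_below_def inf_nat_def min_less_iff_conj dest: S(1) S'(1))
  moreover have "(i, j, i) \<in> S \<inter> S'" if "j < inf l n i" for i j
    using that S(2)[of j i] S'(2)[of j i] by (auto simp: inf_nat_def min_less_iff_conj)
  moreover have "(i, j, 0) \<in> S \<inter> S' \<longleftrightarrow> j < inf m r i" for i j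
    by (auto simp: inf_nat_def min_less_iff_conj S(3) S'(3))
  moreover have "t' \<in> S \<inter> S'" if "forces t t'" "t \<in> S \<inter> S'" for t t'
    using that(2) S(4)[OF that(1)] S'(4)[OF that(1)] by blast
  ultimately show ?thesis
    by (simp add: elegant_sets_def)
qed

text \<open>
  Antitonicity of \<open>l\<close> and \<open>m\<close> enters through the column rule: going up from a cell of \<open>l\<close>
  one stays in \<open>l\<close> and lands either in \<open>m\<close>, where every level is present, or in the skew shape;
  in the latter case the starting cell is outside \<open>m\<close> too, and the strict increase of \<open>T\<close>
  applies.
\<close>

lemma set_of_filling_elegant:
  assumes l: "antimono l" and m: "antimono m" and ml: "m \<le> l"
    and T: "T \<in> elegant_fillings l m"
  shows "set_of_filling l m T \<in> elegant_sets l m"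
proof -
  have ml': "j < l i" if "j < m i" for i j
    using ml that by (meson le_funD order_less_le_trans)
  have lm_anti: "l i' \<le> l i" "m i' \<le> m i" if "i < i'" for i i'
    using l m that by (simp_all add: monotone_def)
  have range: "1 \<le> T (i, j) \<and> T (i, j) \<le> i" if "m i \<le> j" "j < l i" for i j
    using T that by (auto simp: elegant_fillings_def skew_shape_def)
  have row_le: "T (i, j) \<le> T (i, j')" if "m i \<le> j" "j < j'" "j' < l i" for i j j'
    using T that by (auto simp: elegant_fillings_def ssyt_def skew_shape_def)
  have col_less: "T (i, j) < T (i', j)" if "m i \<le> j" "j < l i'" "i < i'" for i i' j
  proof -
    have "(i, j) \<in> skew_shape l m" "(i', j) \<in> skew_shape l m"
      using that lm_anti[OF \<open>i < i'\<close>] by (auto simp: skew_shape_def)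
    then show ?thesis
      using T that by (auto simp: elegant_fillings_def ssyt_def)
  qed
  let ?S = "set_of_filling l m T"
  have "?S \<subseteq> triples_below l"
    by (auto simp: set_of_filling_def triples_below_def ml')
  moreover have "(i, j, i) \<in> ?S" if "j < l i" for i j
    using range[of i j] that by (cases "j < m i") (auto simp: set_of_filling_def)
  moreover have "(i, j, 0) \<in> ?S \<longleftrightarrow> j < m i" for i j
    using range[of i j] by (fastforce simp: set_of_filling_def)
  moreover have "t' \<in> ?S" if "forces t t'" "t \<in> ?S" for t t'
    using that
  proof cases
    case (level k k' i j)
    then show ?thesis using that(2) by (auto simp: set_of_filling_def)
  next
    case (row j j' i k)
    then show ?thesis
      using that(2) row_le[of i j j'] by (force simp: set_of_filling_def not_less)
  next
    case (col i i' k j)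
    then show ?thesis
      using that(2) lm_anti[of i i'] col_less[of i j i']
      by (fastforce simp: set_of_filling_def not_less)
  qed
  ultimately show ?thesis
    by (simp add: elegant_sets_def)
qed

text \<open>
  The least level at which a cell appears is positive because level \<open>0\<close> contains only the cells
  of \<open>m\<close>, and at most \<open>i\<close> in row \<open>i\<close> because level \<open>i\<close> contains all cells of \<open>l\<close>.
\<close>

lemma filling_of_set_elegant:
  assumes S: "S \<in> elegant_sets l m"
  shows "filling_of_set l m S \<in> elegant_fillings l m"
proof -
  let ?T = "filling_of_set l m S"
  have T: "?T (i, j) = (LEAST k. (i, j, k) \<in> S)" if "(i, j) \<in> skew_shape l m" for i j
    using that by (simp add: filling_of_set_def)
  have top: "(i, j, i) \<in> S" and bot: "(i, j, 0) \<notin> S" if "(i, j) \<in> skew_shape l m" for i j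
    using elegant_setsD(2,3)[OF S] that by (auto simp: skew_shape_def)
  have in_S: "(i, j, ?T (i, j)) \<in> S" if "(i, j) \<in> skew_shape l m" for i j
    unfolding T[OF that] using top[OF that] by (rule LeastI)
  have T_le: "?T (i, j) \<le> k" if "(i, j) \<in> skew_shape l m" "(i, j, k) \<in> S" for i j k
    unfolding T[OF that(1)] using that(2) by (rule Least_le)
  have pos: "1 \<le> ?T (i, j)" if "(i, j) \<in> skew_shape l m" for i j
    using in_S[OF that] bot[OF that] by (cases "?T (i, j)") auto
  have row: "?T (i, j) \<le> ?T (i, j')"
    if "(i, j) \<in> skew_shape l m" "(i, j') \<in> skew_shape l m" "j < j'" for i j j'
    using T_le[OF that(1)] elegant_setsD(4)[OF S forces.row[OF that(3)] in_S[OF that(2)]] .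
  have col: "?T (i, j) < ?T (i', j)"
    if c: "(i, j) \<in> skew_shape l m" "(i', j) \<in> skew_shape l m" and i: "i < i'" for i i' j
  proof -
    obtain k where k: "?T (i', j) = Suc k"
      using pos[OF c(2)] by (cases "?T (i', j)") auto
    have "?T (i, j) \<le> k"
    proof (cases "k \<le> i")
      case True
      then have "(i, j, k) \<in> S"
        using elegant_setsD(4)[OF S forces.col[OF i]] in_S[OF c(2)] k by simp
      then show ?thesis by (rule T_le[OF c(1)])
    next
      case False
      \<comment> \<open>The column rule is silent here, but the flag condition alone gives a value at most \<open>i\<close>.\<close>
      then show ?thesis using T_le[OF c(1) top[OF c(1)]] by simp
    qed
    then show ?thesis using k by simp
  qed
  have "?T \<in> extensional (skew_shape l m)"
    by (simp add: filling_of_set_def)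
  then have "?T \<in> skew_shape l m \<rightarrow>\<^sub>E {1..}"
    using pos by (auto simp: PiE_iff)
  then show ?thesis
    using row col pos T_le top by (auto simp: elegant_fillings_def ssyt_def)
qed

lemma filling_of_set_of_filling:
  assumes T: "T \<in> elegant_fillings l m"
  shows "filling_of_set l m (set_of_filling l m T) = T"
proof
  fix c :: "nat \<times> nat"
  obtain i j where c: "c = (i, j)" by (cases c)
  show "filling_of_set l m (set_of_filling l m T) c = T c"
  proof (cases "c \<in> skew_shape l m")
    case True
    have "T (i, j) \<le> i" using T True c by (auto simp: elegant_fillings_def)
    then have "(LEAST k. (i, j, k) \<in> set_of_filling l m T) = T (i, j)"
      using True c by (intro Least_equality) (auto simp: set_of_filling_def skew_shape_def)
    then show ?thesis using True c by (simp add: filling_of_set_def)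
  next
    case False
    moreover have "T c = undefined"
      using T False by (intro PiE_arb[of T _ "\<lambda>_. {1..}"]) (auto simp: elegant_fillings_def ssyt_def)
    ultimately show ?thesis
      by (simp add: filling_of_set_def)
  qed
qed

lemma set_of_filling_of_set:
  assumes S: "S \<in> elegant_sets l m"
  shows "set_of_filling l m (filling_of_set l m S) = S"
proof -
  have up: "(i, j, k') \<in> S" if "(i, j, k) \<in> S" "k \<le> k'" "k' \<le> i" for i j k k'
    using elegant_setsD(4)[OF S forces.level] that by blast
  note sub = elegant_setsD(1)[OF S] and top = elegant_setsD(2)[OF S] and bot = elegant_setsD(3)[OF S]
  have "(i, j, k) \<in> set_of_filling l m (filling_of_set l m S) \<longleftrightarrow> (i, j, k) \<in> S" for i j k
  proof (cases "j < l i \<and> k \<le> i \<and> m i \<le> j")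
    case True
    have "(LEAST k. (i, j, k) \<in> S) \<le> k \<longleftrightarrow> (i, j, k) \<in> S"
      using up[OF LeastI[of "\<lambda>k. (i, j, k) \<in> S", OF top]] Least_le[of "\<lambda>k. (i, j, k) \<in> S"] True
      by blast
    then show ?thesis
      using True by (auto simp: set_of_filling_def filling_of_set_def skew_shape_def)
  next
    case False
    then show ?thesis
      using up[of i j 0 k] bot[of i j] sub[of i j k] by (auto simp: set_of_filling_def)
  qed
  then show ?thesis by auto
qed

lemma g_star_eq_card_elegant_sets:
  assumes "l \<in> partitions" "m \<in> partitions" "m \<le> l"
  shows "g_star l m = card (elegant_sets l m)"
proof -
  have "bij_betw (set_of_filling l m) (elegant_fillings l m) (elegant_sets l m)"
    by (rule bij_betw_byWitness[where f' = "filling_of_set l m"])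
      (use assms in \<open>auto simp: filling_of_set_of_filling set_of_filling_of_set partitions_def
        intro: set_of_filling_elegant filling_of_set_elegant\<close>)
  then show ?thesis
    unfolding g_star_def by (rule bij_betw_same_card)
qed

section \<open>Log-supermodularity of the number of elegant fillings\<close>

theorem lemma10p2:
  fixes l m n r :: "nat \<Rightarrow> nat"
  assumes "l \<in> partitions" and "m \<in> partitions"
    and "n \<in> partitions" and "r \<in> partitions"
    and "m \<le> l" and "r \<le> n"
  shows "g_star l m * g_star n r
           \<le> g_star (sup l n) (sup m r) * g_star (inf l n) (inf m r)"
proof -
  let ?X = "triples_below (sup l n)"
  have sub: "elegant_sets l' m' \<subseteq> Pow ?X" if "l' \<le> sup l n" for l' m'
    using elegant_sets_subset Pow_mono[OF triples_below_mono[OF that]] by (rule subset_trans)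
  have "card (elegant_sets l m) * card (elegant_sets n r)
      \<le> card (elegant_sets (sup l n) (sup m r)) * card (elegant_sets (inf l n) (inf m r))"
  proof (rule Daykin_inequality)
    show "finite ?X" using assms by (intro finite_triples_below partitions_sup)
    have "inf l n \<le> sup l n" by (meson inf_le1 sup_ge1 order_trans)
    then show "elegant_sets (inf l n) (inf m r) \<subseteq> Pow ?X" by (rule sub)
  qed (simp_all only: sub elegant_sets_union elegant_sets_inter sup_ge1 sup_ge2 order_refl)
  moreover have "sup m r \<le> sup l n" "inf m r \<le> inf l n"
    using sup_mono[OF assms(5,6)] inf_mono[OF assms(5,6)] by simp_all
  ultimately show ?thesis
    using assms by (simp add: g_star_eq_card_elegant_sets partitions_sup partitions_inf)
qed

end
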